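(* There are polynomials $P\in S(6,\beta)$ (one for each $\beta<1$ sufficiently close to $1$) with $$|P|_\beta=1-\frac{11}{30}(1-\beta)+\frac{29}{450}(1-\beta)^2+\mathcal O\big((1-\beta)^{5/2}\big).$$
   Context: $\beta$ denotes a real number with $0\le\beta\le 1$. $S(6,\beta)$ is the set of complex polynomials of degree $6$ with all roots in the closed unit disk and at least one root at $\beta$. For a polynomial $P$, $|P|_\beta$ is the distance between $\beta$ and the closest root of the derivative $P'$. The notation $\mathcal O((1-\beta)^s)$ denotes a quantity bounded in modulus by $C(1-\beta)^s$ for all $\beta\in(\beta_0,1)$, with absolute constants $C$ and $\beta_0<1$. *)

theory Defs
  imports "HOL-Analysis.Analysis" "HOL-Computational_Algebra.Computational_Algebra"
begin

definition S :: "nat \<Rightarrow> real \<Rightarrow> complex poly set" where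
  "S n \<beta> = {P. degree P = n \<and> (\<forall>z. poly P z = 0 \<longrightarrow> cmod z \<le> 1)
                 \<and> poly P (complex_of_real \<beta>) = 0}"

(* For degree P \<ge> 2 the set of critical points is finite and nonempty, so the
   infimum is the distance to the closest one (infdist to the empty set would be 0). *)
definition crit_dist :: "complex poly \<Rightarrow> real \<Rightarrow> real" where
  "crit_dist P \<beta> = infdist (complex_of_real \<beta>) {w. poly (pderiv P) w = 0}"

end

theory Submission
  imports Defs
begin

text \<open>
  Write \<open>t = 1 - \<beta>\<close>. The polynomials are perturbations of \<open>z ^ 6 - 1\<close>, whose critical points are all
  at 0. The ones used here have just two critical points, one of them of multiplicity four. If
  \<open>\<beta> - B\<close> is the multiple one and \<open>x = 1 + (z - \<beta>) / B\<close>, such a polynomial is, up to a factor,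
  \<open>x ^ 5 * (x + e) - (1 + e)\<close> for some \<open>e\<close>: it vanishes at \<open>x = 1\<close>, that is at \<open>z = \<beta>\<close>, and its derivative
  is \<open>x ^ 4 * (6 * x + 5 * e)\<close>. The distances from \<open>\<beta>\<close> to the critical points are \<open>\<bar>B\<bar>\<close> and \<open>\<bar>B * (1 + 5/6 * e)\<bar>\<close>.

  To the first order the critical points are \<open>4 * \<i> * s\<close> and four times \<open>- \<i> * s\<close>, with \<open>t = 15 * s\<^sup>2\<close>.
  They move along the imaginary direction, so this costs distance only at the order \<open>s\<^sup>2\<close>, and
  their sum vanishes, so the roots are not moved at the order \<open>s\<close>. Everything
  is expanded in \<open>\<tau> = \<i> * s\<close>, which has the effect that the coefficients of \<open>\<beta>\<close>, \<open>B\<close> and \<open>e\<close> are rational.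
  They are chosen such that both critical distances agree with
  \<open>1 - 11/2 * s\<^sup>2 + 29/2 * s ^ 4 = 1 - 11/30 * t + 29/450 * t\<^sup>2\<close> and the three outer roots near \<open>-1\<close> and near
  the primitive third roots of unity lie on the unit circle, all up to errors of order
  \<open>s ^ 5\<close>; the remaining two roots, near the primitive sixth roots of unity, lie inside by a margin
  of order \<open>s\<^sup>2\<close>.

  That the formal expansions describe the actual roots follows from the simplicity of
  the sixth roots of unity (\<open>trinomial_stable\<close>, \<open>trinomial_root_near\<close>, \<open>root_expansion\<close>), and checking the
  expansions is a computation with truncated polynomials (\<open>outer_roots\<close>, \<open>critical_moduli\<close>). Finally,
  a homothety with centre \<open>\<beta>\<close> and ratio \<open>1 - const * s ^ 5\<close> removes the excess of the outer roots over
  the disk (\<open>shrink_into_disk\<close>) and changes the critical distance only by a term of order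
  \<open>s ^ 5\<close>, which is of order \<open>t powr (5/2)\<close>.
\<close>

section \<open>Polynomial congruences as error bounds\<close>

text \<open>
  Expansions are compared modulo powers of the small variable \<open>\<tau>\<close>, that is, in the ring of
  polynomials in \<open>\<tau>\<close>. This turns each comparison into finitely many identities between
  coefficients, and this lemma turns the result back into an error bound of the order \<open>\<tau> ^ k\<close>.
\<close>
lemma bound_of_monom_dvd:
  fixes p :: "complex poly"
  assumes "monom 1 k dvd p"
  obtains M where "M > 0" "\<And>\<tau>. cmod \<tau> \<le> 1 \<Longrightarrow> cmod (poly p \<tau>) \<le> M * cmod \<tau> ^ k"
proof -
  obtain q where q: "p = monom 1 k * q" using assms by (auto elim: dvdE)
  obtain M where M: "M > 0" "\<And>z. cmod z \<le> 1 \<Longrightarrow> cmod (poly q z) \<le> M"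
    using poly_bound_exists[of 1 q] by blast
  have "cmod (poly p \<tau>) \<le> M * cmod \<tau> ^ k" if "cmod \<tau> \<le> 1" for \<tau>
    using mult_left_mono[OF M(2)[OF that], of "cmod \<tau> ^ k"]
    by (simp add: q poly_monom norm_mult norm_power mult.commute)
  with M(1) show ?thesis by (rule that)
qed

lemma poly_near_zero:
  fixes p :: "complex poly"
  assumes "\<epsilon> > 0" "poly p 0 = w"
  obtains \<delta> where "\<delta> > 0" "\<And>\<tau>. cmod \<tau> < \<delta> \<Longrightarrow> cmod (poly p \<tau> - w) < \<epsilon>"
proof -
  have "isCont (poly p) 0" by simp
  then show ?thesis
    unfolding continuous_at_eps_delta using assms that by (metis dist_norm diff_zero)
qed

text \<open>
  Rewriting with these facts decides a congruence modulo \<open>\<tau> ^ k\<close> between explicit coefficient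
  lists. The variant with \<open>[:1:]\<close> is there because the simplifier puts \<open>monom 1 0\<close> into that form.
\<close>
lemma monom_dvd_simps:
  fixes p :: "'a :: comm_semiring_1 poly"
  shows "monom 1 0 dvd p" "[:1:] dvd p" "monom 1 (Suc k) dvd pCons a p \<longleftrightarrow> a = 0 \<and> monom 1 k dvd p"
proof -
  show "monom 1 0 dvd p" "[:1:] dvd p" by (simp_all add: monom_0 flip: one_pCons)
  show "monom 1 (Suc k) dvd pCons a p \<longleftrightarrow> a = 0 \<and> monom 1 k dvd p"
    by (auto simp: monom_1_dvd_iff' coeff_pCons less_Suc_eq_0_disj)
qed

lemma dvd_mult_diff:
  fixes a b d :: "'a :: comm_ring_1"
  assumes "d dvd a - a'" "d dvd b - b'"
  shows "d dvd a * b - a' * b'"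
proof -
  have "a * b - a' * b' = a * (b - b') + (a - a') * b'" by (simp add: algebra_simps)
  then show ?thesis using assms by (metis dvd_add dvd_mult dvd_mult2)
qed

lemma dvd_diff_trans:
  fixes a b c d :: "'a :: comm_ring_1"
  assumes "d dvd a - b" "d dvd b - c"
  shows "d dvd a - c"
  using dvd_add[OF assms] by simp

text \<open>
  Truncating after every multiplication keeps the coefficients that have to be compared small;
  expanding the sixth power of an approximate root at once would not.
\<close>
lemma dvd_trinomial:
  fixes X E :: "'a :: comm_ring_1"
  assumes X2: "d dvd X * X - X2" and X4: "d dvd X2 * X2 - X4" and X5: "d dvd X4 * X - X5"
    and XE: "d dvd X5 * (X + E) - (1 + E)"
  shows "d dvd X ^ 5 * (X + E) - (1 + E)"
proof -
  have "d dvd (X * X) * (X * X) - X4"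
    using dvd_diff_trans[OF dvd_mult_diff[OF X2 X2] X4] .
  then have "d dvd (X * X) * (X * X) * X - X5"
    by (rule dvd_diff_trans[OF dvd_mult_diff X5]) simp
  then have "d dvd (X * X) * (X * X) * X * (X + E) - (1 + E)"
    by (rule dvd_diff_trans[OF dvd_mult_diff XE]) simp
  then show ?thesis by (simp add: eval_nat_numeral mult.assoc)
qed

section \<open>Perturbed sixth roots of unity\<close>

text \<open>
  Sixth roots of unity are simple roots of \<open>x ^ 6 - 1\<close>: the difference quotient of
  \<open>x ^ 5 * (x + e)\<close> tends to \<open>6 * w ^ 5\<close>, of modulus 6, as both points tend to \<open>w\<close> and \<open>e\<close> to 0.
  Hence, near \<open>w\<close>, the residual of an approximate root bounds its distance from a true root.
\<close>
lemma trinomial_stable: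
  fixes w :: complex
  assumes w: "w ^ 6 = 1"
  obtains \<delta> where "\<delta> > 0"
    "\<And>x y e. \<lbrakk>cmod (x - w) < \<delta>; cmod (y - w) < \<delta>; cmod e < \<delta>\<rbrakk>
      \<Longrightarrow> cmod (x - y) \<le> cmod (x ^ 5 * (x + e) - y ^ 5 * (y + e))"
proof -
  \<comment> \<open>\<open>g\<close> is the difference quotient of \<open>x \<mapsto> x ^ 5 * (x + e)\<close>, jointly continuous in both points and \<open>e\<close>.\<close>
  define g :: "complex \<times> complex \<times> complex \<Rightarrow> complex" where
    "g = (\<lambda>(x, y, e). (\<Sum>i<6. x ^ i * y ^ (5 - i)) + e * (\<Sum>i<5. x ^ i * y ^ (4 - i)))"
  have g: "x ^ 5 * (x + e) - y ^ 5 * (y + e) = (x - y) * g (x, y, e)" for x y e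
    by (simp add: g_def eval_nat_numeral algebra_simps)
  have cont: "isCont g (w, w, 0)"
    unfolding g_def case_prod_unfold by (intro continuous_intros)
  have "w * w ^ 5 = 1" using w by (simp add: eval_nat_numeral)
  then have "cmod w ^ 5 = 1"
    by (metis norm_power power_eq_1_iff w norm_one zero_neq_numeral power_one)
  then have "cmod (g (w, w, 0)) = 6"
    by (simp add: g_def eval_nat_numeral norm_mult)
  moreover have "((\<lambda>p. cmod (g p)) \<longlongrightarrow> cmod (g (w, w, 0))) (nhds (w, w, 0))"
    using cont by (intro tendsto_norm) (simp add: isCont_def tendsto_at_iff_tendsto_nhds)
  ultimately have "eventually (\<lambda>p. 1 < cmod (g p)) (nhds (w, w, 0))"
    by (auto dest: order_tendstoD(1)[of _ _ _ 1])
  then obtain d where d: "d > 0" "\<And>p. dist p (w, w, 0) < d \<Longrightarrow> 1 < cmod (g p)"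
    by (auto simp: eventually_nhds_metric)
  show ?thesis
  proof (rule that[of "d / 3"])
    fix x y e assume h: "cmod (x - w) < d / 3" "cmod (y - w) < d / 3" "cmod e < d / 3"
    have "dist (x, y, e) (w, w, 0) \<le> cmod (x - w) + (cmod (y - w) + cmod e)"
      unfolding dist_Pair_Pair
      by (rule order.trans[OF sqrt_sum_squares_le_sum]; 
          simp add: dist_norm sqrt_sum_squares_le_sum)
    with h have "1 < cmod (g (x, y, e))" by (intro d(2)) linarith
    then show "cmod (x - y) \<le> cmod (x ^ 5 * (x + e) - y ^ 5 * (y + e))"
      unfolding g norm_mult using mult_left_mono[of 1 "cmod (g (x, y, e))" "cmod (x - y)"] by simp
  qed (use d in simp)
qed

lemma sixth_root_factors:
  fixes x w :: complex
  assumes "w\<^sup>2 + w + 1 = 0"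
  shows "x ^ 6 - 1 = (x - 1) * (x - (-1)) * (x - w) * (x - (-1 - w)) * (x - (-w)) * (x - (1 + w))"
  using assms by algebra

text \<open>
  A root satisfies \<open>x ^ 6 - 1 = e * (1 - x ^ 5)\<close>, where the right side is at most \<open>33 * \<bar>e\<bar>\<close> because
  all roots have modulus at most 2 when \<open>e\<close> is small. The left side is the product of the six distances to the
  sixth roots of unity, so these cannot all be large.
\<close>
lemma trinomial_root_near:
  fixes \<delta> :: real
  assumes "\<delta> > 0"
  obtains \<eta> where "\<eta> > 0"
    "\<And>x e. \<lbrakk>cmod e < \<eta>; x ^ 5 * (x + e) = 1 + e\<rbrakk> \<Longrightarrow> \<exists>w. w ^ 6 = 1 \<and> cmod (x - w) < \<delta>"
proof (rule that[of "min (1/2) (\<delta> ^ 6 / 33)"])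
  fix x e :: complex
  assume e: "cmod e < min (1/2) (\<delta> ^ 6 / 33)" and eq: "x ^ 5 * (x + e) = 1 + e"
  have x2: "cmod x \<le> 2"
  proof (rule ccontr)
    assume "\<not> cmod x \<le> 2"
    then have n: "cmod x > 2" by simp
    have "cmod (x + e) \<ge> 3/2" using e n norm_triangle_ineq2[of x "-e"] by simp
    moreover have "cmod x ^ 5 \<ge> 2 ^ 5" using n by (intro power_mono) auto
    ultimately have "2 ^ 5 * (3/2) \<le> cmod x ^ 5 * cmod (x + e)" by (intro mult_mono) auto
    also have "\<dots> = cmod (1 + e)" by (metis eq norm_mult norm_power)
    also have "\<dots> \<le> 1 + 1/2" using e norm_triangle_ineq[of 1 e] by simp
    finally show False by simp
  qed
  define w where "w = Complex (-1/2) (sqrt 3 / 2)"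
  have w: "w\<^sup>2 + w + 1 = 0"
    by (simp add: w_def complex_eq_iff power2_eq_square)
  have "x ^ 6 - 1 = e * (1 - x ^ 5)" using eq by (simp add: eval_nat_numeral algebra_simps)
  then have "cmod (x ^ 6 - 1) = cmod e * cmod (1 - x ^ 5)" by (simp add: norm_mult)
  also have "\<dots> \<le> cmod e * 33"
  proof (intro mult_left_mono)
    have "cmod (1 - x ^ 5) \<le> 1 + cmod x ^ 5" using norm_triangle_ineq4[of 1 "x ^ 5"] by (simp add: norm_power)
    also have "cmod x ^ 5 \<le> 2 ^ 5" using x2 by (intro power_mono) auto
    finally show "cmod (1 - x ^ 5) \<le> 33" by simp
  qed simp
  also have "\<dots> < \<delta> ^ 6" using e by simp
  finally have small: "cmod (x ^ 6 - 1) < \<delta> ^ 6" .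
  show "\<exists>w. w ^ 6 = 1 \<and> cmod (x - w) < \<delta>"
  proof (rule ccontr)
    assume "\<not> ?thesis"
    then have far: "\<delta> \<le> cmod (x - v)" if "v ^ 6 = 1" for v using that by force
    have r: "w ^ 6 = 1" "(- 1 - w) ^ 6 = 1" "(- w) ^ 6 = 1" "(1 + w) ^ 6 = 1"
      using w by algebra+
    have r1: "(-1 :: complex) ^ 6 = 1" by simp
    have "\<delta> ^ 6 = \<delta> * \<delta> * \<delta> * \<delta> * \<delta> * \<delta>" by (simp add: eval_nat_numeral)
    also have "\<dots> \<le> cmod (x - 1) * cmod (x - (-1)) * cmod (x - w) * cmod (x - (-1 - w))
        * cmod (x - (-w)) * cmod (x - (1 + w))"
      using far[OF r(1)] far[OF r(2)] far[OF r(3)] far[OF r(4)] far[OF r1] far[of 1] assms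
      by (intro mult_mono mult_nonneg_nonneg) auto
    also have "\<dots> = cmod (x ^ 6 - 1)"
      by (simp only: sixth_root_factors[OF w] norm_mult)
    finally show False using small by simp
  qed
qed (use assms in simp)

text \<open>
  A formal expansion \<open>X\<close> of a root modulo \<open>\<tau> ^ k\<close> describes the actual root near \<open>w\<close> with an error
  of order \<open>\<tau> ^ k\<close>. The affine image \<open>Z\<close> of the expansion then does the same for the image of
  the root.
\<close>
lemma root_expansion:
  fixes w :: complex and X Z E b B :: "complex poly"
  assumes w: "w ^ 6 = 1" and X0: "poly X 0 = w" and E0: "poly E 0 = 0"
    and X: "monom 1 k dvd X ^ 5 * (X + E) - (1 + E)"
    and Z: "monom 1 k dvd b + B * (X - 1) - Z"
  obtains M \<delta> where "M > 0" "\<delta> > 0"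
    "\<And>\<tau> x. \<lbrakk>cmod \<tau> < \<delta>; cmod (x - w) < \<delta>; x ^ 5 * (x + poly E \<tau>) = 1 + poly E \<tau>\<rbrakk>
      \<Longrightarrow> cmod (poly b \<tau> + poly B \<tau> * (x - 1) - poly Z \<tau>) \<le> M * cmod \<tau> ^ k"
proof -
  obtain d where d: "d > 0"
    "\<And>x y e. \<lbrakk>cmod (x - w) < d; cmod (y - w) < d; cmod e < d\<rbrakk>
      \<Longrightarrow> cmod (x - y) \<le> cmod (x ^ 5 * (x + e) - y ^ 5 * (y + e))"
    using trinomial_stable[OF w] by blast
  obtain M1 where M1: "M1 > 0" "\<And>\<tau>. cmod \<tau> \<le> 1 \<Longrightarrow>
      cmod (poly (X ^ 5 * (X + E) - (1 + E)) \<tau>) \<le> M1 * cmod \<tau> ^ k"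
    using bound_of_monom_dvd[OF X] by blast
  obtain M2 where M2: "M2 > 0" "\<And>\<tau>. cmod \<tau> \<le> 1 \<Longrightarrow>
      cmod (poly (b + B * (X - 1) - Z) \<tau>) \<le> M2 * cmod \<tau> ^ k"
    using bound_of_monom_dvd[OF Z] by blast
  obtain M3 where M3: "M3 > 0" "\<And>\<tau>. cmod \<tau> \<le> 1 \<Longrightarrow> cmod (poly B \<tau>) \<le> M3"
    using poly_bound_exists[of 1 B] by blast
  obtain d1 where d1: "d1 > 0" "\<And>\<tau>. cmod \<tau> < d1 \<Longrightarrow> cmod (poly X \<tau> - w) < d"
    using poly_near_zero[OF d(1) X0] by blast
  obtain d2 where d2: "d2 > 0" "\<And>\<tau>. cmod \<tau> < d2 \<Longrightarrow> cmod (poly E \<tau>) < d"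
    using poly_near_zero[OF d(1) E0] by auto
  show ?thesis
  proof (rule that[of "M3 * M1 + M2" "Min {d, d1, d2, 1}"])
    fix \<tau> x assume \<tau>: "cmod \<tau> < Min {d, d1, d2, 1}" and x: "cmod (x - w) < Min {d, d1, d2, 1}"
      and eq: "x ^ 5 * (x + poly E \<tau>) = 1 + poly E \<tau>"
    have "cmod (x - poly X \<tau>) \<le> cmod (x ^ 5 * (x + poly E \<tau>) - poly X \<tau> ^ 5 * (poly X \<tau> + poly E \<tau>))"
      using \<tau> x by (intro d(2) d1(2) d2(2)) auto
    also have "\<dots> = cmod (poly (X ^ 5 * (X + E) - (1 + E)) \<tau>)"
      by (simp add: eq norm_minus_commute)
    also have "\<dots> \<le> M1 * cmod \<tau> ^ k" using \<tau> by (intro M1(2)) simp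
    finally have 1: "cmod (x - poly X \<tau>) \<le> M1 * cmod \<tau> ^ k" .
    have "poly b \<tau> + poly B \<tau> * (x - 1) - poly Z \<tau>
        = poly B \<tau> * (x - poly X \<tau>) + poly (b + B * (X - 1) - Z) \<tau>"
      by (simp add: algebra_simps)
    also have "cmod \<dots> \<le> cmod (poly B \<tau>) * cmod (x - poly X \<tau>) + cmod (poly (b + B * (X - 1) - Z) \<tau>)"
      by (metis norm_mult norm_triangle_ineq)
    also have "\<dots> \<le> M3 * (M1 * cmod \<tau> ^ k) + M2 * cmod \<tau> ^ k"
      using \<tau> 1 M3(1) by (intro add_mono mult_mono M3(2) M2(2)) auto
    finally show "cmod (poly b \<tau> + poly B \<tau> * (x - 1) - poly Z \<tau>) \<le> (M3 * M1 + M2) * cmod \<tau> ^ k"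
      by (simp add: algebra_simps)
  qed (use M1 M2 M3 d d1 d2 in \<open>auto intro!: add_pos_pos mult_pos_pos\<close>)
qed


section \<open>The expansions of the five outer roots\<close>

text \<open>
  The values at \<open>\<tau> = \<i> * s\<close> are the root \<open>\<beta> = 1 - 15 * s\<^sup>2\<close>, the factor \<open>B\<close> and the coefficient \<open>e\<close>. The latter
  two are the truncations of \<open>r * exp (\<tau> - 59/12 * \<tau> ^ 3)\<close>, where \<open>r = 1 + 11/2 * \<tau>\<^sup>2 + 29/2 * \<tau> ^ 4\<close>,
  and of \<open>6/5 * (exp (865/12 * \<tau> ^ 3 - 5 * \<tau>) - 1)\<close>. The exponentials have modulus 1 for imaginary \<open>\<tau>\<close>,
  which puts all critical points at distance \<open>r\<close> from \<open>\<beta>\<close>, up to the truncation; the two cubic coefficients solve the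
  equations saying that the outer roots near \<open>-1\<close> and near the primitive third roots of unity
  lie on the unit circle up to the order \<open>\<tau> ^ 5\<close>.
\<close>
definition beta_poly :: "complex poly" where "beta_poly = [:1, 0, 15:]"
definition scale_poly :: "complex poly" where "scale_poly = [:1, 1, 6, 3/4, 99/8:]"
definition coeff_poly :: "complex poly" where "coeff_poly = [:0, -6, 15, 123/2, -1605/4:]"

text \<open>
  For imaginary \<open>\<tau>\<close>, complex conjugation acts on polynomials in \<open>\<tau>\<close> by conjugating the coefficients
  and changing the sign of \<open>\<tau>\<close>; with \<open>Z'\<close> obtained from \<open>Z\<close> in this way, the squared modulus is the
  polynomial \<open>Z * Z'\<close>. Since \<open>\<rho>\<close> stays away from 0, an expansion of the squared modulus
  gives one of the modulus.
\<close>
lemma modulus_expansion: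
  fixes Z Z' R :: "complex poly" and \<rho> :: "real \<Rightarrow> real"
  assumes conj: "\<And>s. cnj (poly Z (\<i> * of_real s)) = poly Z' (\<i> * of_real s)"
    and R: "\<And>s. poly R (\<i> * of_real s) = of_real (\<rho> s)"
    and pos: "\<And>s. \<lbrakk>0 \<le> s; s \<le> 1/4\<rbrakk> \<Longrightarrow> 1/2 \<le> \<rho> s"
    and ZZ: "monom 1 k dvd Z * Z' - R * R"
  obtains M where "M > 0"
    "\<And>s. \<lbrakk>0 \<le> s; s \<le> 1/4\<rbrakk> \<Longrightarrow> \<bar>cmod (poly Z (\<i> * of_real s)) - \<rho> s\<bar> \<le> M * s ^ k"
proof -
  obtain M where M: "M > 0" "\<And>\<tau>. cmod \<tau> \<le> 1 \<Longrightarrow>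
      cmod (poly (Z * Z' - R * R) \<tau>) \<le> M * cmod \<tau> ^ k"
    using bound_of_monom_dvd[OF ZZ] by blast
  show ?thesis
  proof (rule that[of "2 * M"])
    fix s :: real assume s: "0 \<le> s" "s \<le> 1/4"
    let ?z = "poly Z (\<i> * of_real s)"
    have "complex_of_real ((cmod ?z)\<^sup>2) = ?z * poly Z' (\<i> * of_real s)"
      by (metis complex_norm_square conj)
    then have "complex_of_real ((cmod ?z)\<^sup>2 - (\<rho> s)\<^sup>2) = poly (Z * Z' - R * R) (\<i> * of_real s)"
      by (simp add: R power2_eq_square)
    then have "\<bar>(cmod ?z)\<^sup>2 - (\<rho> s)\<^sup>2\<bar> = cmod (poly (Z * Z' - R * R) (\<i> * of_real s))"
      by (metis norm_of_real)
    also have "\<dots> \<le> M * s ^ k" using M(2)[of "\<i> * of_real s"] s by (simp add: norm_mult)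
    also have "(cmod ?z)\<^sup>2 - (\<rho> s)\<^sup>2 = (cmod ?z - \<rho> s) * (cmod ?z + \<rho> s)"
      by (simp add: power2_eq_square algebra_simps)
    finally have "\<bar>cmod ?z - \<rho> s\<bar> * (cmod ?z + \<rho> s) \<le> M * s ^ k"
      using pos[OF s] by (simp add: abs_mult)
    moreover have "\<bar>cmod ?z - \<rho> s\<bar> * (1/2) \<le> \<bar>cmod ?z - \<rho> s\<bar> * (cmod ?z + \<rho> s)"
      using pos[OF s] by (intro mult_left_mono) (simp_all add: add_increasing)
    ultimately have "\<bar>cmod ?z - \<rho> s\<bar> * (1/2) \<le> M * s ^ k" by (rule order_trans[rotated])
    then show "\<bar>cmod ?z - \<rho> s\<bar> \<le> 2 * M * s ^ k" by simp
  qed (use M in simp)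
qed

abbreviation coeff_at :: "real \<Rightarrow> complex" where
  "coeff_at s \<equiv> poly coeff_poly (\<i> * of_real s)"

abbreviation root_at :: "real \<Rightarrow> complex \<Rightarrow> complex" where
  "root_at s x \<equiv> poly beta_poly (\<i> * of_real s) + poly scale_poly (\<i> * of_real s) * (x - 1)"

text \<open>
  One number \<open>N\<close> serves as error constant and as inverse of both radii. The property is then
  monotone in \<open>N\<close>, so the finitely many roots of unity can share one constant. The bound on the
  real part separates the outer roots from \<open>\<beta>\<close>, which makes it possible to pull them
  into the disk later.
\<close>
definition outer_root_bound :: "real \<Rightarrow> complex \<Rightarrow> bool" where
  "outer_root_bound N w \<longleftrightarrow>
    (\<forall>s x. 0 < s \<and> s < 1 / N \<and> cmod (x - w) < 1 / N \<and> x ^ 5 * (x + coeff_at s) = 1 + coeff_at s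
       \<longrightarrow> x = 1 \<or> cmod (root_at s x) \<le> 1 + N * s ^ 5 \<and> Re (root_at s x) \<le> 3/4)"

lemma outer_root_boundI:
  assumes "M > 0" "\<delta> > 0"
    and "\<And>s x. \<lbrakk>0 < s; s < \<delta>; cmod (x - w) < \<delta>; x ^ 5 * (x + coeff_at s) = 1 + coeff_at s\<rbrakk>
      \<Longrightarrow> x = 1 \<or> cmod (root_at s x) \<le> 1 + M * s ^ 5 \<and> Re (root_at s x) \<le> 3/4"
  shows "\<exists>N>0. outer_root_bound N w"
proof -
  define N where "N = M + 1 / \<delta>"
  have N: "N > 0" "M \<le> N" "1 / N \<le> \<delta>"
    using assms(1,2) by (auto simp: N_def field_simps add_pos_pos)
  have "outer_root_bound N w"
    unfolding outer_root_bound_def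
  proof (intro allI impI, elim conjE, goal_cases)
    case (1 s x)
    then have "M * s ^ 5 \<le> N * s ^ 5" using N by (intro mult_right_mono) auto
    moreover have "s < \<delta>" "cmod (x - w) < \<delta>" using 1 N by linarith+
    ultimately show ?case using assms(3)[OF 1(1) _ _ 1(4)] by auto
  qed
  with N show ?thesis by blast
qed

text \<open>
  In the two cases for \<open>c\<close>, the outer root lies on the unit circle up to an error of order
  \<open>s ^ 5\<close>, or it lies inside by a margin of order \<open>s\<^sup>2\<close>, and then the expansion may be cruder.
\<close>
lemma outer_root_bound_if_expansion:
  fixes w :: complex and X Z Z' :: "complex poly" and c :: real
  assumes w: "w ^ 6 = 1" "Re w \<le> 1/2"
    and X0: "poly X 0 = w" and Z0: "poly Z 0 = w"
    and X: "monom 1 k dvd X ^ 5 * (X + coeff_poly) - (1 + coeff_poly)"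
    and Z: "monom 1 k dvd beta_poly + scale_poly * (X - 1) - Z"
    and conj: "\<And>s. cnj (poly Z (\<i> * of_real s)) = poly Z' (\<i> * of_real s)"
    and ZZ: "monom 1 k dvd Z * Z' - [:1, 0, of_real c:] * [:1, 0, of_real c:]"
    and c: "c = 0 \<and> k = 5 \<or> 0 < c \<and> c \<le> 8 \<and> k = 3"
  shows "\<exists>N>0. outer_root_bound N w"
proof -
  have E0: "poly coeff_poly 0 = 0" by (simp add: coeff_poly_def)
  obtain M1 d1 where 1: "M1 > 0" "d1 > 0"
    "\<And>\<tau> x. \<lbrakk>cmod \<tau> < d1; cmod (x - w) < d1; x ^ 5 * (x + poly coeff_poly \<tau>) = 1 + poly coeff_poly \<tau>\<rbrakk>
      \<Longrightarrow> cmod (poly beta_poly \<tau> + poly scale_poly \<tau> * (x - 1) - poly Z \<tau>) \<le> M1 * cmod \<tau> ^ k"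
    using root_expansion[OF w(1) X0 E0 X Z] by blast
  have R: "poly [:1, 0, of_real c:] (\<i> * of_real s) = complex_of_real (1 - c * s\<^sup>2)" for s
    by (simp add: power2_eq_square complex_eq_iff)
  have pos: "1/2 \<le> 1 - c * s\<^sup>2" if "0 \<le> s" "s \<le> 1/4" for s :: real
  proof -
    have "c * s\<^sup>2 \<le> 8 * s\<^sup>2" using c by (intro mult_right_mono) auto
    moreover have "s\<^sup>2 \<le> (1/4)\<^sup>2" using that by (intro power_mono) auto
    ultimately show ?thesis by (simp add: power2_eq_square)
  qed
  obtain M2 where 2: "M2 > 0"
    "\<And>s. \<lbrakk>0 \<le> s; s \<le> 1/4\<rbrakk> \<Longrightarrow> \<bar>cmod (poly Z (\<i> * of_real s)) - (1 - c * s\<^sup>2)\<bar> \<le> M2 * s ^ k"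
    using modulus_expansion[OF conj R pos ZZ] by blast
  obtain d2 where d2: "d2 > 0" "\<And>\<tau>. cmod \<tau> < d2 \<Longrightarrow> cmod (poly Z \<tau> - w) < 1/8"
    using poly_near_zero[OF _ Z0, of "1/8"] by auto
  define M where "M = M1 + M2"
  define d3 where "d3 = (if c = 0 then 1 else c / M)"
  have d3: "d3 > 0" using 1(1) 2(1) c by (auto simp: d3_def M_def add_pos_pos)
  show ?thesis
  proof (rule outer_root_boundI[of M "Min {1/4, d1, d2, 1 / (8 * M1), d3}"])
    fix s :: real and x
    assume s: "0 < s" "s < Min {1/4, d1, d2, 1 / (8 * M1), d3}"
      and x: "cmod (x - w) < Min {1/4, d1, d2, 1 / (8 * M1), d3}"
      and eq: "x ^ 5 * (x + coeff_at s) = 1 + coeff_at s"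
    let ?\<tau> = "\<i> * complex_of_real s"
    have \<tau>: "cmod ?\<tau> = s" using s by (simp add: norm_mult)
    have A: "cmod (root_at s x - poly Z ?\<tau>) \<le> M1 * s ^ k"
      using 1(3)[of ?\<tau> x] \<tau> s x eq by simp
    have "cmod (root_at s x) \<le> cmod (poly Z ?\<tau>) + cmod (root_at s x - poly Z ?\<tau>)"
      by (metis norm_triangle_sub)
    also have "\<dots> \<le> (1 - c * s\<^sup>2 + M2 * s ^ k) + M1 * s ^ k"
      using 2(2)[of s] s A by (intro add_mono) auto
    finally have "cmod (root_at s x) \<le> 1 - c * s\<^sup>2 + M * s ^ k" by (simp add: M_def algebra_simps)
    also have "\<dots> \<le> 1 + M * s ^ 5"
    proof (cases "c = 0")
      case False
      have "M * s \<le> c" using s False 1(1) 2(1) by (simp add: d3_def M_def field_simps)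
      then have "M * s * s\<^sup>2 \<le> c * s\<^sup>2" by (rule mult_right_mono) simp
      moreover have "M * s ^ k = M * s * s\<^sup>2" using False c by (simp add: eval_nat_numeral)
      moreover have "0 \<le> M * s ^ 5" using s 1(1) 2(1) by (simp add: M_def)
      ultimately show ?thesis by linarith
    qed (use c in auto)
    finally have z: "cmod (root_at s x) \<le> 1 + M * s ^ 5" .
    have "s ^ k \<le> s" using power_decreasing[of 1 k s] s c by auto
    then have "M1 * s ^ k \<le> M1 * s" using 1(1) by simp
    also have "\<dots> \<le> 1/8" using s 1(1) by (simp add: field_simps)
    finally have "cmod (root_at s x - poly Z ?\<tau>) \<le> 1/8" using A by simp
    moreover have "cmod (poly Z ?\<tau> - w) < 1/8" using d2(2)[of ?\<tau>] \<tau> s by simp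
    moreover have "Re (root_at s x) = Re (root_at s x - poly Z ?\<tau>) + Re (poly Z ?\<tau> - w) + Re w" by simp
    ultimately have "Re (root_at s x) \<le> 3/4"
      using w(2) complex_Re_le_cmod[of "root_at s x - poly Z ?\<tau>"] complex_Re_le_cmod[of "poly Z ?\<tau> - w"]
      by linarith
    with z show "x = 1 \<or> cmod (root_at s x) \<le> 1 + M * s ^ 5 \<and> Re (root_at s x) \<le> 3/4" by blast
  qed (use 1 2 d2 d3 in \<open>auto simp: M_def\<close>)
qed

lemma outer_root_bound_minus_one: "\<exists>N>0. outer_root_bound N (-1)"
proof -
  let ?X = "[:-1, 2, -5, -43/6, 725/12:] :: complex poly"
  let ?Z = "[:-1, 0, 0, -5/3:] :: complex poly"
  let ?Z' = "[:-1, 0, 0, 5/3:] :: complex poly"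
  have X: "monom 1 5 dvd ?X ^ 5 * (?X + coeff_poly) - (1 + coeff_poly)"
    by (rule dvd_trinomial[where ?X2.0 = "[:1, -4, 14, -17/3, -249/2:]" and ?X4.0 = "[:1, -8, 44, -370/3, -23/3:]"
          and ?X5.0 = "[:-1, 10, -65, 1465/6, -1365/4:]"])
      (simp_all add: monom_dvd_simps coeff_poly_def one_pCons numeral_eq_Suc)
  have Z: "monom 1 5 dvd beta_poly + scale_poly * (?X - 1) - ?Z"
    by (simp add: monom_dvd_simps beta_poly_def scale_poly_def one_pCons numeral_eq_Suc)
  have ZZ: "monom 1 5 dvd ?Z * ?Z' - [:1, 0, of_real 0:] * [:1, 0, of_real 0:]"
    by (simp add: monom_dvd_simps numeral_eq_Suc)
  show ?thesis
    by (rule outer_root_bound_if_expansion[OF _ _ _ _ X Z _ ZZ]) simp_all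
qed

text \<open>
  The coefficients live in the field generated by \<open>w\<close>, where \<open>w\<^sup>2 = - w - 1\<close> reduces all
  products; conjugation sends \<open>w\<close> to \<open>- 1 - w\<close>. Both primitive third roots of unity are covered.
\<close>
lemma outer_root_bound_third:
  assumes w: "w\<^sup>2 + w + 1 = 0" and n: "cmod w = 1"
  shows "\<exists>N>0. outer_root_bound N w"
proof -
  let ?X = "[:w, 1 - w, -5 - 5/2*w, -1/4 + 121/4*w, 1035/8 + 15/2*w:] :: complex poly"
  let ?Z = "[:w, 0, 5 + 5/2*w, 45/2*w, 175/2 + 275/8*w:] :: complex poly"
  let ?Z' = "[:-1-w, 0, 5 + 5/2*(-1-w), -45/2*(-1-w), 175/2 + 275/8*(-1-w):] :: complex poly"
  have ww: "w * w = - w - 1" "w * (w * a) = (- w - 1) * a" for a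
    using w by algebra+
  have "w * cnj w = 1" using n by (simp add: complex_norm_square [symmetric])
  then have c: "cnj w = - 1 - w" using w by algebra
  then have re: "Re w = -1/2" by (auto simp: complex_eq_iff)
  have X: "monom 1 5 dvd ?X ^ 5 * (?X + coeff_poly) - (1 + coeff_poly)"
    by (rule dvd_trinomial[where
          ?X2.0 = "[:-1 - w, 2 + 4*w, 5 - 8*w, -151/2 - 61*w, 255/4 + 384*w:]" and
          ?X4.0 = "[:w, 4 - 4*w, -38 - 10*w, 113 + 223*w, 1575/2 - 1263/2*w:]" and
          ?X5.0 = "[:-1 - w, 5 + 10*w, 25/2 - 85/2*w, -1325/4 - 245/2*w, 1245 + 17895/8*w:]"])
      (simp_all add: monom_dvd_simps coeff_poly_def one_pCons numeral_eq_Suc field_simps ww)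
  have Z: "monom 1 5 dvd beta_poly + scale_poly * (?X - 1) - ?Z"
    by (simp add: monom_dvd_simps beta_poly_def scale_poly_def one_pCons numeral_eq_Suc field_simps ww)
  have ZZ: "monom 1 5 dvd ?Z * ?Z' - [:1, 0, of_real 0:] * [:1, 0, of_real 0:]"
    by (simp add: monom_dvd_simps numeral_eq_Suc field_simps ww)
  have w6: "w ^ 6 = 1" using w by algebra
  have conj: "cnj (poly ?Z (\<i> * of_real s)) = poly ?Z' (\<i> * of_real s)" for s
    by (simp add: c field_simps)
  show ?thesis
    by (rule outer_root_bound_if_expansion[OF w6 _ _ _ X Z conj ZZ]) (simp_all add: re)
qed

text \<open>
  Here \<open>Z * Z'\<close> is \<open>1 + 15 * \<tau>\<^sup>2 = 1 - 15 * s\<^sup>2\<close> modulo \<open>\<tau> ^ 3\<close>, so these roots stay well inside the disk.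
\<close>
lemma outer_root_bound_sixth:
  assumes w: "w\<^sup>2 - w + 1 = 0" and n: "cmod w = 1"
  shows "\<exists>N>0. outer_root_bound N w"
proof -
  let ?X = "[:w, 1 - w, - 5/2*w:] :: complex poly"
  let ?Z = "[:w, 0, 10 + 5/2*w:] :: complex poly"
  let ?Z' = "[:1-w, 0, 10 + 5/2*(1-w):] :: complex poly"
  have ww: "w * w = w - 1" "w * (w * a) = (w - 1) * a" for a
    using w by algebra+
  have "w * cnj w = 1" using n by (simp add: complex_norm_square [symmetric])
  then have c: "cnj w = 1 - w" using w by algebra
  then have re: "Re w = 1/2" by (auto simp: complex_eq_iff)
  have X: "monom 1 3 dvd ?X ^ 5 * (?X + coeff_poly) - (1 + coeff_poly)"
    by (rule dvd_trinomial[where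
          ?X2.0 = "[:-1 + w, 2, 5 - 6*w:]" and
          ?X4.0 = "[:-w, -4 + 4*w, 6 + 10*w:]" and
          ?X5.0 = "[:1 - w, -5, -25/2 + 45/2*w:]"])
      (simp_all add: monom_dvd_simps coeff_poly_def one_pCons numeral_eq_Suc field_simps ww)
  have Z: "monom 1 3 dvd beta_poly + scale_poly * (?X - 1) - ?Z"
    by (simp add: monom_dvd_simps beta_poly_def scale_poly_def one_pCons numeral_eq_Suc field_simps ww)
  have ZZ: "monom 1 3 dvd ?Z * ?Z' - [:1, 0, of_real (15/2):] * [:1, 0, of_real (15/2):]"
    by (simp add: monom_dvd_simps numeral_eq_Suc field_simps ww)
  have w6: "w ^ 6 = 1" using w by algebra
  have conj: "cnj (poly ?Z (\<i> * of_real s)) = poly ?Z' (\<i> * of_real s)" for s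
    by (simp add: c field_simps)
  show ?thesis
    by (rule outer_root_bound_if_expansion[OF w6 _ _ _ X Z conj ZZ]) (simp_all add: re)
qed


lemma sixth_root_cases:
  fixes w :: complex
  assumes "w ^ 6 = 1"
  shows "w = 1 \<or> w = -1 \<or> w\<^sup>2 + w + 1 = 0 \<or> w\<^sup>2 - w + 1 = 0"
proof -
  have "(w - 1) * (w + 1) * (w\<^sup>2 + w + 1) * (w\<^sup>2 - w + 1) = w ^ 6 - 1" by algebra
  then show ?thesis using assms by (auto simp: eq_neg_iff_add_eq_0)
qed

text \<open>
  \<open>x = 1\<close> solves the equation for every \<open>e\<close>, and it is the only solution near 1.
\<close>
lemma outer_root_bound_one: "\<exists>N>0. outer_root_bound N 1"
proof -
  obtain d where d: "d > 0"
    "\<And>x y e. \<lbrakk>cmod (x - 1) < d; cmod (y - 1) < d; cmod e < d\<rbrakk>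
      \<Longrightarrow> cmod (x - y) \<le> cmod (x ^ 5 * (x + e) - y ^ 5 * (y + e))"
    by (rule trinomial_stable[of 1]) auto
  obtain d1 where d1: "d1 > 0" "\<And>\<tau>. cmod \<tau> < d1 \<Longrightarrow> cmod (poly coeff_poly \<tau>) < d"
    using poly_near_zero[OF d(1), of coeff_poly 0] by (auto simp: coeff_poly_def)
  show ?thesis
  proof (rule outer_root_boundI[of 1 "min d d1"], goal_cases)
    case (3 s x)
    then have "cmod (\<i> * complex_of_real s) < d1" by (simp add: norm_mult)
    from d1(2)[OF this] 3 have "cmod (x - 1) \<le> 0"
      using d(2)[of x 1 "poly coeff_poly (\<i> * complex_of_real s)"] d(1) by simp
    then show ?case by simp
  qed (use d(1) d1(1) in auto)
qed

lemma outer_roots: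
  obtains N where "N > 0"
    "\<And>s x. \<lbrakk>0 < s; s < 1 / N; x ^ 5 * (x + coeff_at s) = 1 + coeff_at s\<rbrakk>
      \<Longrightarrow> x = 1 \<or>
       cmod (root_at s x) \<le> 1 + N * s ^ 5
       \<and> Re (root_at s x) \<le> 3/4"
proof -
  let ?W = "{w :: complex. w ^ 6 = 1}"
  have fin: "finite ?W" by (rule finite_roots_unity) simp
  have "\<exists>N>0. outer_root_bound N w" if "w ^ 6 = 1" for w
  proof -
    have "cmod w = 1" using that by (metis power_eq_1_iff zero_neq_numeral)
    then show ?thesis
      using sixth_root_cases[OF that] outer_root_bound_one outer_root_bound_minus_one
        outer_root_bound_third outer_root_bound_sixth by blast
  qed
  then obtain f where f: "\<And>w. w ^ 6 = 1 \<Longrightarrow> f w > 0 \<and> outer_root_bound (f w) w" by metis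
  define N1 where "N1 = Max (f ` ?W)"
  have N1: "f w \<le> N1" if "w ^ 6 = 1" for w using fin that by (auto simp: N1_def)
  then have N1_pos: "N1 > 0" using order_less_le_trans[OF conjunct1[OF f[of 1]] N1[of 1]] by simp
  obtain d where d: "d > 0" "\<And>x e. \<lbrakk>cmod e < d; x ^ 5 * (x + e) = 1 + e\<rbrakk> \<Longrightarrow> \<exists>w. w ^ 6 = 1 \<and> cmod (x - w) < 1 / N1"
    using trinomial_root_near[of "1 / N1"] N1_pos by auto
  obtain d1 where d1: "d1 > 0" "\<And>\<tau>. cmod \<tau> < d1 \<Longrightarrow> cmod (poly coeff_poly \<tau>) < d"
    using poly_near_zero[OF d(1), of coeff_poly 0] by (auto simp: coeff_poly_def)
  define N where "N = max N1 (1 / d1)"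
  have N: "N > 0" "N1 \<le> N" "1 / N \<le> d1" "1 / N \<le> 1 / N1" using N1_pos d1(1)
    by (auto simp: N_def field_simps max_def)
  show ?thesis
  proof (rule that[OF N(1)], goal_cases)
    case (1 s x)
    then have "cmod (\<i> * complex_of_real s) < d1" using N by (simp add: norm_mult)
    from d(2)[OF d1(2)[OF this] 1(3)] obtain w where w: "w ^ 6 = 1" "cmod (x - w) < 1 / N1" by blast
    have le: "1 / N1 \<le> 1 / f w" using f[OF w(1)] N1[OF w(1)] by (simp add: frac_le)
    have "f w * s ^ 5 \<le> N * s ^ 5" using N1[OF w(1)] N 1 by (intro mult_right_mono) auto
    moreover have "s < 1 / f w" "cmod (x - w) < 1 / f w" using 1 w N le by linarith+
    moreover have "x = 1 \<or> cmod (root_at s x) \<le> 1 + f w * s ^ 5 \<and> Re (root_at s x) \<le> 3/4"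
      using f[OF w(1)] 1(1,3) calculation(2,3) unfolding outer_root_bound_def by blast
    ultimately show ?case by auto
  qed
qed

section \<open>The polynomials and their critical points\<close>

text \<open>
  This is \<open>x ^ 5 * (x + e) - (1 + e)\<close> in the variable \<open>x = 1 + (z - b) / B\<close>, multiplied by \<open>B ^ 6\<close>
  to clear denominators.
\<close>
definition trinomial_at :: "complex \<Rightarrow> complex \<Rightarrow> complex \<Rightarrow> complex poly" where
  "trinomial_at b B e = [:B - b, 1:] ^ 5 * [:B - b + e * B, 1:] - [:B ^ 6 * (1 + e):]"

lemma poly_trinomial_at: "poly (trinomial_at b B e) z = (z - b + B) ^ 5 * (z - b + B + e * B) - B ^ 6 * (1 + e)"
  by (simp add: trinomial_at_def algebra_simps)

lemma degree_trinomial_at: "degree (trinomial_at b B e) = 6"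
proof -
  have "degree ([:B - b, 1:] ^ 5 * [:B - b + e * B, 1:]) = 6"
    by (subst degree_mult_eq) (simp_all add: degree_power_eq)
  moreover have "trinomial_at b B e = [:B - b, 1:] ^ 5 * [:B - b + e * B, 1:] + [:- (B ^ 6 * (1 + e)):]"
    by (simp add: trinomial_at_def)
  ultimately show ?thesis by (simp add: degree_add_eq_left del: mult_pCons_right)
qed

lemma trinomial_at_root:
  assumes "B \<noteq> 0" "poly (trinomial_at b B e) z = 0"
  obtains x where "z = b + B * (x - 1)" "x ^ 5 * (x + e) = 1 + e"
proof (rule that[of "(z - b + B) / B"])
  define x where "x = (z - b + B) / B"
  have "z - b + B = B * x" using assms by (simp add: x_def)
  then have "B ^ 6 * (x ^ 5 * (x + e)) = B ^ 6 * (1 + e)"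
    using assms(2) unfolding poly_trinomial_at by algebra
  then show "((z - b + B) / B) ^ 5 * ((z - b + B) / B + e) = 1 + e"
    using assms(1) by (simp flip: x_def)
  show "z = b + B * ((z - b + B) / B - 1)" using assms(1) by (simp add: field_simps)
qed

lemma crit_points_trinomial_at:
  "{z. poly (pderiv (trinomial_at b B e)) z = 0} = {b - B, b - B * (1 + 5/6 * e)}"
proof -
  have "poly (pderiv (trinomial_at b B e)) z = 6 * (z - (b - B)) ^ 4 * (z - (b - B * (1 + 5/6 * e)))" for z
    by (simp add: trinomial_at_def pderiv_mult pderiv_diff pderiv_power pderiv_pCons eval_nat_numeral algebra_simps)
  then show ?thesis by auto
qed

lemma crit_dist_trinomial_at:
  "crit_dist (trinomial_at (of_real \<beta>) B e) \<beta> = min (cmod B) (cmod (B * (1 + 5/6 * e)))"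
proof -
  have "infdist p {u, v} = min (dist p u) (dist p v)" for p u v :: complex
    unfolding infdist_def by (simp add: cInf_eq_Min)
  then show ?thesis
    unfolding crit_dist_def crit_points_trinomial_at by (simp add: dist_norm)
qed

section \<open>Pulling the outer roots into the disk\<close>

text \<open>
  Moving \<open>z\<close> towards \<open>\<beta>\<close> by the fraction \<open>\<lambda>\<close> decreases \<open>\<bar>z\<bar>\<^sup>2\<close> at the rate \<open>2 * (\<bar>z\<bar>\<^sup>2 - \<beta> * Re z)\<close> in
  \<open>\<lambda>\<close>, which is about \<open>1/2\<close> or more when \<open>\<bar>z\<bar>\<close> is about 1 and \<open>Re z \<le> 3/4\<close>. The choice \<open>\<lambda> = 12 * \<eta>\<close> therefore
  beats an excess of \<open>\<eta>\<close> with room for the quadratic terms.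
\<close>
lemma shrink_into_disk:
  fixes z :: complex and \<beta> \<eta> :: real
  assumes "0 \<le> \<beta>" "\<beta> \<le> 1" "cmod z \<le> 1 + \<eta>" "Re z \<le> 3/4" "0 \<le> \<eta>" "\<eta> \<le> 1/24"
  shows "cmod ((1 - 12 * \<eta>) * z + 12 * \<eta> * \<beta>) \<le> 1"
proof -
  define l where "l = 12 * \<eta>"
  have l: "0 \<le> l" "l \<le> 1/2" using assms by (auto simp: l_def)
  have "(cmod z)\<^sup>2 \<le> (1 + \<eta>)\<^sup>2" using assms by (intro power_mono) auto
  also have "\<dots> = 1 + 2 * \<eta> + \<eta> * \<eta>" by (simp add: power2_eq_square algebra_simps)
  also have "\<dots> \<le> 1 + 3 * \<eta>" using mult_right_mono[of \<eta> 1 \<eta>] assms by simp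
  finally have z: "(cmod z)\<^sup>2 \<le> 1 + 3 * \<eta>" .
  have "\<beta> * Re z \<le> \<beta> * (3/4)" using assms by (intro mult_left_mono) auto
  then have re: "\<beta> * Re z \<le> 3/4" using assms by simp
  have b: "\<beta>\<^sup>2 \<le> 1" using assms by (simp add: power_le_one)
  have "(cmod ((1 - 12 * \<eta>) * z + 12 * \<eta> * \<beta>))\<^sup>2 = (1 - l)\<^sup>2 * (cmod z)\<^sup>2 + 2 * l * (1 - l) * (\<beta> * Re z) + l\<^sup>2 * \<beta>\<^sup>2"
    unfolding cmod_power2 by (simp add: l_def power2_eq_square algebra_simps)
  also have "\<dots> \<le> (1 - l)\<^sup>2 * (1 + 3 * \<eta>) + 2 * l * (1 - l) * (3/4) + l\<^sup>2 * 1"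
    using l z re b by (intro add_mono mult_left_mono) auto
  also have "\<dots> = 1 - l / 2 + l * l / 2 + (1 - l)\<^sup>2 * (3 * \<eta>)" by (simp add: power2_eq_square algebra_simps)
  also have "\<dots> \<le> 1 - l / 2 + l / 4 + 3 * \<eta>"
  proof -
    have "(1 - l)\<^sup>2 * (3 * \<eta>) \<le> 1 * (3 * \<eta>)" using l assms by (intro mult_right_mono) (auto simp: power_le_one)
    moreover have "l * l \<le> l * (1/2)" using l by (intro mult_left_mono) auto
    ultimately show ?thesis by simp
  qed
  also have "\<dots> = 1" by (simp add: l_def)
  finally show ?thesis by (simp add: power_le_one_iff abs_square_le_1)
qed

lemma critical_moduli:
  obtains M where "M > 0"
    "\<And>s. \<lbrakk>0 \<le> s; s \<le> 1/4\<rbrakk> \<Longrightarrow>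
      \<bar>min (cmod (poly scale_poly (\<i> * of_real s)))
         (cmod (poly scale_poly (\<i> * of_real s) * (1 + 5/6 * coeff_at s)))
       - (1 - 11/2 * s\<^sup>2 + 29/2 * s ^ 4)\<bar> \<le> M * s ^ 5"
proof -
  let ?R = "[:1, 0, 11/2, 0, 29/2:] :: complex poly"
  let ?\<rho> = "\<lambda>s :: real. 1 - 11/2 * s\<^sup>2 + 29/2 * s ^ 4"
  let ?U = "1 + smult (5/6) coeff_poly"
  let ?B' = "[:1, -1, 6, -3/4, 99/8:] :: complex poly"
  let ?U' = "[:1, 5, 25/2, -205/4, -2675/8:] :: complex poly"
  have R: "poly ?R (\<i> * of_real s) = of_real (?\<rho> s)" for s
    by (simp add: eval_nat_numeral algebra_simps)
  have pos: "1/2 \<le> ?\<rho> s" if "0 \<le> s" "s \<le> 1/4" for s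
  proof -
    have "s\<^sup>2 \<le> (1/4)\<^sup>2" using that by (intro power_mono) auto
    then have "s\<^sup>2 \<le> 1/16" by (simp add: power2_eq_square)
    moreover have "0 \<le> s ^ 4" by simp
    ultimately show ?thesis by linarith
  qed
  have cB: "cnj (poly scale_poly (\<i> * of_real s)) = poly ?B' (\<i> * of_real s)" for s
    by (simp add: scale_poly_def algebra_simps)
  have cU: "cnj (poly ?U (\<i> * of_real s)) = poly ?U' (\<i> * of_real s)" for s
    by (simp add: coeff_poly_def algebra_simps)
  have "monom 1 5 dvd scale_poly * ?B' - ?R * ?R"
    by (simp add: scale_poly_def monom_dvd_simps numeral_eq_Suc)
  then obtain M1 where M1: "M1 > 0" "\<And>s. \<lbrakk>0 \<le> s; s \<le> 1/4\<rbrakk> \<Longrightarrow>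
      \<bar>cmod (poly scale_poly (\<i> * of_real s)) - ?\<rho> s\<bar> \<le> M1 * s ^ 5"
    using modulus_expansion[OF cB R pos] by blast
  have "cnj (poly (scale_poly * ?U) (\<i> * of_real s)) = poly (?B' * ?U') (\<i> * of_real s)" for s
    by (simp only: poly_mult complex_cnj_mult cB cU)
  moreover have "monom 1 5 dvd (scale_poly * ?U) * (?B' * ?U') - ?R * ?R"
    by (simp add: scale_poly_def coeff_poly_def one_pCons monom_dvd_simps numeral_eq_Suc)
  ultimately obtain M2 where M2: "M2 > 0" "\<And>s. \<lbrakk>0 \<le> s; s \<le> 1/4\<rbrakk> \<Longrightarrow>
      \<bar>cmod (poly (scale_poly * ?U) (\<i> * of_real s)) - ?\<rho> s\<bar> \<le> M2 * s ^ 5"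
    using modulus_expansion[OF _ R pos] by blast
  show ?thesis
  proof (rule that[of "M1 + M2"], goal_cases)
    case (2 s)
    have "0 \<le> M1 * s ^ 5" "0 \<le> M2 * s ^ 5" using M1(1) M2(1) 2 by auto
    then show ?case using M1(2)[OF 2] M2(2)[OF 2] by (simp add: min_def algebra_simps)
  qed (use M1 M2 in simp)
qed

section \<open>The extremal family\<close>

text \<open>
  Multiplying \<open>B\<close> by \<open>1 - 12 * N * s ^ 5\<close> is the homothety with centre \<open>\<beta>\<close> and this ratio: it
  fixes the root \<open>\<beta>\<close>, pulls the outer roots into the disk, and scales the critical distance,
  changing it only by a term of order \<open>s ^ 5\<close>.
\<close>
lemma extremal_family:
  obtains N M :: real where "N > 0" "M > 0" 
    "\<And>s. \<lbrakk>0 < s; s < 1 / N\<rbrakk> \<Longrightarrow> \<exists>P \<in> S 6 (1 - 15 * s\<^sup>2).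
        \<bar>crit_dist P (1 - 15 * s\<^sup>2) - (1 - 11/2 * s\<^sup>2 + 29/2 * s ^ 4)\<bar> \<le> M * s ^ 5"
proof -
  obtain N where N: "N > 0"
    "\<And>s x. \<lbrakk>0 < s; s < 1 / N; x ^ 5 * (x + coeff_at s) = 1 + coeff_at s\<rbrakk>
      \<Longrightarrow> x = 1 \<or>
       cmod (root_at s x) \<le> 1 + N * s ^ 5
       \<and> Re (root_at s x) \<le> 3/4"
    using outer_roots by blast
  obtain M where M: "M > 0" 
    "\<And>s. \<lbrakk>0 \<le> s; s \<le> 1/4\<rbrakk> \<Longrightarrow>
      \<bar>min (cmod (poly scale_poly (\<i> * of_real s)))
         (cmod (poly scale_poly (\<i> * of_real s) * (1 + 5/6 * coeff_at s)))
       - (1 - 11/2 * s\<^sup>2 + 29/2 * s ^ 4)\<bar> \<le> M * s ^ 5"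
    using critical_moduli by blast
  show ?thesis
  proof (rule that[of "24 * N + 4 * M + 4" "M + 12 * N * (30 + M)"])
    fix s :: real assume s: "0 < s" "s < 1 / (24 * N + 4 * M + 4)"
    \<comment> \<open>These three bounds give \<open>\<beta> \<ge> 0\<close>, \<open>\<eta> \<le> 1/24\<close> (so that the ratio is positive) and \<open>m > 0\<close>.\<close>
    have s4: "s \<le> 1/4" and s24: "N * s \<le> 1/24" and Ms: "M * s \<le> 1/4"
    proof -
      have "s * (24 * N + 4 * M + 4) < 1" using s N(1) M(1) by (simp add: pos_less_divide_eq)
      then have "24 * (N * s) + 4 * (M * s) + 4 * s < 1" by (simp add: algebra_simps)
      moreover have "0 < N * s" "0 < M * s" using s N(1) M(1) by simp_all
      ultimately show "s \<le> 1/4" "N * s \<le> 1/24" "M * s \<le> 1/4" using s(1) by linarith+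
    qed
    then have sN: "s < 1 / N" using N(1) by (simp add: pos_less_divide_eq mult.commute)
    let ?\<tau> = "\<i> * complex_of_real s"
    \<comment> \<open>\<open>B0\<close> and \<open>m\<close> belong to the polynomial before the homothety, \<open>B\<close> to the one after it.\<close>
    define \<beta> where "\<beta> = 1 - 15 * s\<^sup>2"
    define \<eta> where "\<eta> = N * s ^ 5"
    define B0 where "B0 = poly scale_poly ?\<tau>"
    define B where "B = of_real (1 - 12 * \<eta>) * B0"
    define e where "e = poly coeff_poly ?\<tau>"
    define m where "m = min (cmod B0) (cmod (B0 * (1 + 5/6 * e)))"
    let ?r = "1 - 11/2 * s\<^sup>2 + 29/2 * s ^ 4"
    let ?P = "trinomial_at (of_real \<beta>) B e"
    have "s\<^sup>2 \<le> (1/4)\<^sup>2" using s s4 by (intro power_mono) auto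
    then have s2: "s\<^sup>2 \<le> 1/16" by (simp add: power2_eq_square)
    have \<beta>: "0 \<le> \<beta>" "\<beta> \<le> 1" using s2 by (simp_all add: \<beta>_def)
    have b: "poly beta_poly ?\<tau> = of_real \<beta>"
      by (simp add: beta_poly_def \<beta>_def power2_eq_square)
    have "s ^ 5 \<le> s" using power_decreasing[of 1 5 s] s s4 by simp
    then have "N * s ^ 5 \<le> N * s" using N(1) by simp
    then have \<eta>: "0 \<le> \<eta>" "\<eta> \<le> 1/24" using order_trans[OF _ s24] N(1) s by (simp_all add: \<eta>_def)
    have m: "\<bar>m - ?r\<bar> \<le> M * s ^ 5"
      using M(2)[of s] s s4 by (simp add: m_def B0_def e_def)
    have s5: "0 \<le> s ^ 5" "s ^ 5 \<le> 1" "0 \<le> s ^ 4" "s ^ 4 \<le> 1" using s s4 by (simp_all add: power_le_one)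
    have "M * s ^ 5 \<le> M * s" using \<open>s ^ 5 \<le> s\<close> M(1) by simp
    then have m_le: "m \<le> 30 + M" and "0 < m"
      using m Ms s2 s5 M(1) zero_le_power2[of s] by linarith+
    then have B: "B \<noteq> 0" using \<eta> by (auto simp: B_def m_def simp del: of_real_diff of_real_mult)
    have m0: "0 \<le> m" using \<open>0 < m\<close> by simp
    show "\<exists>P \<in> S 6 (1 - 15 * s\<^sup>2).
        \<bar>crit_dist P (1 - 15 * s\<^sup>2) - ?r\<bar> \<le> (M + 12 * N * (30 + M)) * s ^ 5"
    proof -
      have "?P \<in> S 6 \<beta>"
        unfolding S_def
      proof (intro CollectI conjI allI impI)
        show "degree ?P = 6" by (rule degree_trinomial_at)
        show "poly ?P (of_real \<beta>) = 0"
          by (simp add: poly_trinomial_at eval_nat_numeral algebra_simps)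
        fix z assume "poly ?P z = 0"
        then obtain x where x: "z = \<beta> + B * (x - 1)" "x ^ 5 * (x + e) = 1 + e"
          using trinomial_at_root[OF B] by blast
        show "cmod z \<le> 1"
        proof (cases "x = 1")
          case True
          then show ?thesis using x \<beta> by simp
        next
          case False
          let ?y = "\<beta> + B0 * (x - 1)"
          have "cmod ?y \<le> 1 + \<eta>" "Re ?y \<le> 3/4"
            using N(2)[OF s(1) sN, of x] x(2) False unfolding b \<eta>_def B0_def e_def by auto
          then have "cmod ((1 - 12 * \<eta>) * ?y + 12 * \<eta> * \<beta>) \<le> 1"
            using \<beta> \<eta> by (intro shrink_into_disk) auto
          also have "(1 - 12 * \<eta>) * ?y + 12 * \<eta> * \<beta> = z"
            by (simp add: x(1) B_def algebra_simps)
          finally show ?thesis .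
        qed
      qed
      moreover have "crit_dist ?P \<beta> = (1 - 12 * \<eta>) * m"
      proof -
        have "cmod B = (1 - 12 * \<eta>) * cmod B0" "cmod (B * (1 + 5/6 * e)) = (1 - 12 * \<eta>) * cmod (B0 * (1 + 5/6 * e))"
          using \<eta> unfolding B_def norm_mult norm_of_real by simp_all
        then show ?thesis using \<eta> unfolding crit_dist_trinomial_at m_def
          by (simp add: min_mult_distrib_left)
      qed
      moreover have "\<bar>(1 - 12 * \<eta>) * m - ?r\<bar> \<le> (M + 12 * N * (30 + M)) * s ^ 5"
      proof -
        have "\<bar>(1 - 12 * \<eta>) * m - ?r\<bar> = \<bar>(m - ?r) - 12 * \<eta> * m\<bar>"
          by (simp add: algebra_simps)
        also have "\<dots> \<le> \<bar>m - ?r\<bar> + \<bar>12 * \<eta> * m\<bar>" by (rule abs_triangle_ineq4)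
        also have "\<bar>12 * \<eta> * m\<bar> = 12 * \<eta> * m" using \<eta> m0 by simp
        also have "\<bar>m - ?r\<bar> + 12 * \<eta> * m \<le> M * s ^ 5 + 12 * \<eta> * (30 + M)"
          using m m_le \<eta> by (intro add_mono mult_left_mono) auto
        finally show ?thesis by (simp add: \<eta>_def algebra_simps)
      qed
      ultimately show ?thesis unfolding \<beta>_def by force
    qed
  qed (use N(1) M(1) in \<open>auto intro!: add_pos_pos mult_pos_pos\<close>)
qed

theorem proposition6:
  shows "\<exists>C \<beta>\<^sub>0 :: real. 0 \<le> \<beta>\<^sub>0 \<and> \<beta>\<^sub>0 < 1 \<and>
    (\<forall>\<beta>. \<beta>\<^sub>0 < \<beta> \<and> \<beta> < 1 \<longrightarrow>
      (\<exists>P \<in> S 6 \<beta>.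
        \<bar>crit_dist P \<beta> - (1 - 11 / 30 * (1 - \<beta>) + 29 / 450 * (1 - \<beta>)\<^sup>2)\<bar>
          \<le> C * (1 - \<beta>) powr (5 / 2)))"
proof -
  obtain N M :: real where N: "N > 0" "M > 0" 
    "\<And>s. \<lbrakk>0 < s; s < 1 / N\<rbrakk> \<Longrightarrow> \<exists>P \<in> S 6 (1 - 15 * s\<^sup>2).
        \<bar>crit_dist P (1 - 15 * s\<^sup>2) - (1 - 11/2 * s\<^sup>2 + 29/2 * s ^ 4)\<bar> \<le> M * s ^ 5"
    using extremal_family by blast
  show ?thesis
  proof (rule exI[of _ M], rule exI[of _ "max 0 (1 - 15 / N\<^sup>2)"], intro conjI allI impI)
    show "max 0 (1 - 15 / N\<^sup>2) < 1" using N(1) by simp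
  next
    fix \<beta> :: real assume \<beta>: "max 0 (1 - 15 / N\<^sup>2) < \<beta> \<and> \<beta> < 1"
    define s where "s = sqrt ((1 - \<beta>) / 15)"
    have s: "0 < s" and s2: "s\<^sup>2 = (1 - \<beta>) / 15" using \<beta> by (simp_all add: s_def)
    have "s\<^sup>2 < (1 / N)\<^sup>2" using \<beta> N(1) by (simp add: s2 power_divide field_simps)
    then have sN: "s < 1 / N" using N(1) by (simp add: power_less_imp_less_base)
    have s4: "s ^ 4 = (1 - \<beta>)\<^sup>2 / 225"
    proof -
      have "s ^ 4 = (s\<^sup>2)\<^sup>2" by simp
      then show ?thesis by (simp add: s2 power_divide)
    qed
    have "s ^ 5 = s powr 5" using s by (simp add: powr_numeral)
    also have "\<dots> = ((1 - \<beta>) / 15) powr (5 / 2)" using \<beta> by (simp add: s_def powr_half_sqrt[symmetric] powr_powr)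
    also have "\<dots> \<le> (1 - \<beta>) powr (5 / 2)" using \<beta> by (intro powr_mono2) auto
    finally have "M * s ^ 5 \<le> M * (1 - \<beta>) powr (5 / 2)" using N(2) by simp
    moreover have "1 - 15 * s\<^sup>2 = \<beta>" by (simp add: s2 field_simps)
    moreover have "1 - 11/2 * s\<^sup>2 + 29/2 * s ^ 4 = 1 - 11 / 30 * (1 - \<beta>) + 29 / 450 * (1 - \<beta>)\<^sup>2"
      by (simp add: s2 s4)
    ultimately show "\<exists>P \<in> S 6 \<beta>.
        \<bar>crit_dist P \<beta> - (1 - 11 / 30 * (1 - \<beta>) + 29 / 450 * (1 - \<beta>)\<^sup>2)\<bar>
          \<le> M * (1 - \<beta>) powr (5 / 2)"
      using N(3)[OF s sN] by force
  qed simp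
qed

end
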